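(* Let $\mathcal{V}=\{1,\dots,n_y\}$ be the finite set of available sensing nodes, and for $\mathcal{S}\subseteq\mathcal{V}$ let $V_o(\mathcal{S})\in\mathbb{R}^{n_x\times n_x}$ be the parameterized variational observability Gramian, around an initial state $x_0\in\mathcal{X}_0$ and over the observation horizon $\mathrm{N}\ge 1$, of the discrete-time nonlinear system $x_{k+1}=x_k+\tilde f(x_k)$, $y_k=\tilde C x_k$. Then the (matrix-valued) set function $\mathcal{S}\mapsto V_o(\mathcal{S})$ is modular, i.e. for every $\mathcal{S}\subseteq\mathcal{V}$, $$V_o(\mathcal{S})=V_o(\emptyset)+\sum_{j\in\mathcal{S}}V_o(\{j\}).$$
   Context: System. $\mathcal{M}\subseteq\mathbb{R}^{n_x}$ is the (open) state space, and $\tilde f:\mathcal{M}\to\mathbb{R}^{n_x}$ is smooth (at least twice continuously differentiable). The system is $x_{k+1}=x_k+\tilde f(x_k)$, $y_k=\tilde C x_k$, $k=0,1,2,\dots$, with $x_k\in\mathbb{R}^{n_x}$, $y_k\in\mathbb{R}^{n_y}$. Standing assumption: there is a compact set $\mathcal{X}\subseteq\mathcal{M}$ such that the trajectory remains in $\mathcal{X}$ for every initial state $x_0\in\mathcal{X}_0$ and every $k\ge 0$, where $\mathcal{X}_0\subseteq\mathcal{X}$ is the set of initial states. Sensor parameterization. Sensor $j\in\mathcal{V}$ has a measurement row $c_j\in\mathbb{R}^{1\times n_x}$. For $\mathcal{S}\subseteq\mathcal{V}$, $\tilde C=\tilde C(\mathcal{S})\in\mathbb{R}^{n_y\times n_x}$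 is the matrix whose $j$-th row is $c_j$ if $j\in\mathcal{S}$ (sensor selected) and $0$ otherwise. Variational mapping. For the trajectory from $x_0$, $\Phi_0^k\in\mathbb{R}^{n_x\times n_x}$ is the Jacobian $\partial x_k/\partial x_0$; thus $\Phi_0^0=I_{n_x}$ and, by the chain rule, $\Phi_0^k=\Phi_{k-1}^k\Phi_{k-2}^{k-1}\cdots\Phi_0^1$ with $\Phi_{i-1}^{i}=I_{n_x}+\frac{\partial\tilde f}{\partial x}(x_{i-1})$. Gramian. $\Psi_0^k:=\tilde C(\mathcal{S})\Phi_0^k$, and $\Psi\in\mathbb{R}^{\mathrm{N}n_y\times n_x}$ is the vertical stacking of $\Psi_0^0,\Psi_0^1,\dots,\Psi_0^{\mathrm{N}-1}$. The variational observability Gramian is $V_o(\mathcal{S}):=\Psi^\top\Psi=\sum_{k=0}^{\mathrm{N}-1}(\Phi_0^k)^\top\tilde C(\mathcal{S})^\top\tilde C(\mathcal{S})\Phi_0^k$. Modularity. A real-valued set function $f$ on $2^{\mathcal{V}}$ is modular if $f(\mathcal{S})=w(\emptyset)+\sum_{s\in\mathcal{S}}w(s)$ for a constant $w(\emptyset)$ and a weight function $w$ on $\mathcal{V}$; for matrix-valued functions it is understood as the identity displayed in the claim. *)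

theory Defs
  imports "HOL-Analysis.Analysis"
begin

text \<open>The state dimension is the cardinality of \<open>'n\<close>; the sensing nodes are the elements of \<open>'m\<close>,
  which also indexes the rows of the output matrix.\<close>

text \<open>Twice continuous differentiability on an open set, with the first and second derivatives
  taken in the operator-norm spaces of bounded linear maps.\<close>

definition C2_on :: "'a::real_normed_vector set \<Rightarrow> ('a \<Rightarrow> 'b::real_normed_vector) \<Rightarrow> bool"
  where "C2_on M f \<longleftrightarrow>
    (\<exists>(f' :: 'a \<Rightarrow> 'a \<Rightarrow>\<^sub>L 'b) (f'' :: 'a \<Rightarrow> 'a \<Rightarrow>\<^sub>L 'a \<Rightarrow>\<^sub>L 'b).
       (\<forall>x\<in>M. (f has_derivative blinfun_apply (f' x)) (at x)) \<and>
       (\<forall>x\<in>M. (f' has_derivative blinfun_apply (f'' x)) (at x)) \<and>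
       continuous_on M f'')"

primrec trajectory :: "('a::plus \<Rightarrow> 'a) \<Rightarrow> 'a \<Rightarrow> nat \<Rightarrow> 'a"
  where
    "trajectory f x0 0 = x0"
  | "trajectory f x0 (Suc k) = trajectory f x0 k + f (trajectory f x0 k)"

definition sensor_matrix :: "('m::finite \<Rightarrow> real^'n) \<Rightarrow> 'm set \<Rightarrow> real^'n^'m"
  where "sensor_matrix c S = (\<chi> j. if j \<in> S then c j else 0)"

text \<open>The Jacobian of the time-\<open>k\<close> state with respect to the initial state. Here \<open>f\<close> is a total
  function, of which only the restriction to the open state space is meaningful; the
  Jacobian depends on that restriction alone as long as the trajectory stays in the state
  space, see \<open>variational_matrix_Suc\<close> below.\<close>

definition variational_matrix :: "(real^'n \<Rightarrow> real^'n) \<Rightarrow> real^'n \<Rightarrow> nat \<Rightarrow> real^'n^'n"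
  where "variational_matrix f x0 k = matrix (frechet_derivative (\<lambda>z. trajectory f z k) (at x0))"

text \<open>The stacked matrix with blocks for \<open>k = 0, \<dots>, N - 1\<close> is represented as the family of its rows:
  its row number \<open>k \<sqdot> n\<^sub>y + i\<close> is the \<open>i\<close>-th row of the \<open>k\<close>-th block and carries the index \<open>(k, i)\<close>,
  where \<open>k < N\<close>.\<close>

definition observability_row ::
    "(real^'n \<Rightarrow> real^'n) \<Rightarrow> ('m::finite \<Rightarrow> real^'n) \<Rightarrow> real^'n \<Rightarrow> 'm set \<Rightarrow> nat \<times> 'm \<Rightarrow> real^'n"
  where "observability_row f c x0 S =
    (\<lambda>(k, i). row i (sensor_matrix c S ** variational_matrix f x0 k))"

text \<open>The product of the transpose of the stacked matrix with the stacked matrix, entrywise.\<close>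

definition variational_gramian ::
    "(real^'n \<Rightarrow> real^'n) \<Rightarrow> ('m::finite \<Rightarrow> real^'n) \<Rightarrow> real^'n \<Rightarrow> nat \<Rightarrow> 'm set \<Rightarrow> real^'n^'n"
  where "variational_gramian f c x0 N S =
    (\<chi> a b. \<Sum>r\<in>{..<N} \<times> UNIV. observability_row f c x0 S r $ a * observability_row f c x0 S r $ b)"

lemma variational_gramian_eq_sum:
  fixes f :: "real^'n \<Rightarrow> real^'n" and c :: "'m::finite \<Rightarrow> real^'n"
  shows "variational_gramian f c x0 N S =
    (\<Sum>k<N. transpose (variational_matrix f x0 k) ** transpose (sensor_matrix c S) **
       sensor_matrix c S ** variational_matrix f x0 k)"
proof -
  have "(\<Sum>k<N. transpose (variational_matrix f x0 k) ** transpose (sensor_matrix c S) **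
         sensor_matrix c S ** variational_matrix f x0 k) =
    (\<Sum>k<N. transpose (sensor_matrix c S ** variational_matrix f x0 k) **
       (sensor_matrix c S ** variational_matrix f x0 k))"
    by (simp add: matrix_transpose_mul matrix_mul_assoc)
  also have "\<dots> = variational_gramian f c x0 N S"
  proof -
    have "(transpose A ** A) $ a $ b = (\<Sum>i\<in>UNIV. row i A $ a * row i A $ b)"
      for A :: "real^'n^'m" and a b
      by (simp add: matrix_matrix_mult_def transpose_def row_def)
    then show ?thesis
      by (simp add: vec_eq_iff variational_gramian_def observability_row_def
          sum.cartesian_product')
  qed
  finally show ?thesis ..
qed

lemma trajectory_differentiable:
  fixes f :: "real^'n \<Rightarrow> real^'n"
  assumes "C2_on M f" and "\<And>k. trajectory f x0 k \<in> M"
  shows "(\<lambda>z. trajectory f z k) differentiable (at x0)"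
proof (induction k)
  case 0
  then show ?case by simp
next
  case (Suc k)
  have "f differentiable (at (trajectory f x0 k))"
    using assms unfolding C2_on_def differentiable_def by blast
  then have "(\<lambda>z. f (trajectory f z k)) differentiable (at x0)"
    using Suc differentiable_chain_at[of "\<lambda>z. trajectory f z k" x0 f] by (simp add: o_def)
  then show ?case using Suc by simp
qed

lemma variational_matrix_0: "variational_matrix f x0 0 = mat 1"
  by (simp add: variational_matrix_def matrix_id_mat_1[unfolded id_def])

lemma variational_matrix_Suc:
  fixes f :: "real^'n \<Rightarrow> real^'n"
  assumes "C2_on M f" and "\<And>k. trajectory f x0 k \<in> M"
  shows "variational_matrix f x0 (Suc k) =
    (mat 1 + matrix (frechet_derivative f (at (trajectory f x0 k)))) ** variational_matrix f x0 k"
proof -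
  define D where "D = frechet_derivative (\<lambda>z. trajectory f z k) (at x0)"
  define F where "F = frechet_derivative f (at (trajectory f x0 k))"
  have D: "((\<lambda>z. trajectory f z k) has_derivative D) (at x0)"
    using trajectory_differentiable[OF assms] frechet_derivative_works D_def by blast
  have "f differentiable (at (trajectory f x0 k))"
    using assms unfolding C2_on_def differentiable_def by blast
  then have F: "(f has_derivative F) (at (trajectory f x0 k))"
    using frechet_derivative_works F_def by blast
  have "((\<lambda>z. f (trajectory f z k)) has_derivative (\<lambda>h. F (D h))) (at x0)"
    using diff_chain_at[OF D F] by (simp add: o_def)
  then have "((\<lambda>z. trajectory f z (Suc k)) has_derivative (\<lambda>h. D h + F (D h))) (at x0)"
    using D by (auto intro: has_derivative_add)
  then have eq: "frechet_derivative (\<lambda>z. trajectory f z (Suc k)) (at x0) = (\<lambda>h. D h + F (D h))"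
    using frechet_derivative_at by metis
  have lin: "linear D" "linear F"
    using D F has_derivative_linear by auto
  have "matrix (\<lambda>h. D h + F (D h)) = matrix D + matrix (F \<circ> D)"
    by (simp add: matrix_def vec_eq_iff)
  also have "\<dots> = mat 1 ** matrix D + matrix F ** matrix D"
    using lin by (simp add: matrix_compose)
  also have "\<dots> = (mat 1 + matrix F) ** matrix D"
    by (simp only: vec_eq_iff matrix_matrix_mult_def vector_add_component vec_lambda_beta
        distrib_right sum.distrib simp_thms)
  finally show ?thesis
    using eq by (simp add: variational_matrix_def D_def F_def)
qed

end

theory Submission
  imports Defs
begin

text \<open>The row of sensor \<open>j\<close> in each block vanishes unless \<open>j\<close> is selected, and selected rows do not
  depend on the rest of \<open>S\<close>. Since the Gramian is a sum of products of entries from one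
  and the same row, it splits into one contribution per selected sensor.\<close>

lemma observability_row_eq:
  fixes c :: "'m::finite \<Rightarrow> real^'n"
  shows "observability_row f c x0 S (k, j) =
    (if j \<in> S then c j v* variational_matrix f x0 k else 0)"
  by (simp add: observability_row_def sensor_matrix_def row_def matrix_matrix_mult_def
      vector_matrix_mult_def vec_eq_iff mult.commute)

text \<open>Here \<open>S\<close> enters only as the index set of the outer sum; the summands do not
  depend on it, so modularity can be read off entrywise.\<close>

lemma variational_gramian_nth_eq_sum_sensors:
  fixes c :: "'m::finite \<Rightarrow> real^'n"
  shows "variational_gramian f c x0 N S $ a $ b =
    (\<Sum>j\<in>S. \<Sum>k<N. (c j v* variational_matrix f x0 k) $ a * (c j v* variational_matrix f x0 k) $ b)"
proof -
  let ?p = "\<lambda>k j. (c j v* variational_matrix f x0 k) $ a * (c j v* variational_matrix f x0 k) $ b"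
  \<comment> \<open>Both factors come from the same row, so their two conditions
    \<open>j \<in> S\<close> merge into one.\<close>
  have "variational_gramian f c x0 N S $ a $ b = (\<Sum>k<N. \<Sum>j\<in>UNIV. if j \<in> S then ?p k j else 0)"
    by (auto simp: variational_gramian_def sum.cartesian_product' observability_row_eq
        intro!: sum.cong)
  also have "\<dots> = (\<Sum>k<N. \<Sum>j\<in>S. ?p k j)"
    by (simp flip: sum.inter_restrict)
  also have "\<dots> = (\<Sum>j\<in>S. \<Sum>k<N. ?p k j)"
    by (rule sum.swap)
  finally show ?thesis .
qed

theorem theorem4:
  fixes M X X0 :: "(real^'n) set"
    and f :: "real^'n \<Rightarrow> real^'n"
    and c :: "'m::finite \<Rightarrow> real^'n"
    and x0 :: "real^'n"
    and N :: nat
  assumes "open M"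
    and "C2_on M f"
    and "compact X" and "X \<subseteq> M" and "X0 \<subseteq> X"
    and "\<And>z k. z \<in> X0 \<Longrightarrow> trajectory f z k \<in> X"
    and "x0 \<in> X0"
    and "N \<ge> 1"
  shows "\<forall>S :: 'm set. variational_gramian f c x0 N S =
    variational_gramian f c x0 N {} + (\<Sum>j\<in>S. variational_gramian f c x0 N {j})"
  \<comment> \<open>In each entry, \<open>{}\<close> contributes the empty sum 0 and
    \<open>{j}\<close> exactly the summand of \<open>j\<close>.\<close>
  by (simp add: vec_eq_iff variational_gramian_nth_eq_sum_sensors)

end
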